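(* Let $M$ be a metric space. Let $\tau$ be any topology on the space $C(M)$ lying between the pointwise topology $\tau_p$ and the compact-open topology $\tau_k$, i.e. $\tau_p\subseteq\tau\subseteq\tau_k$. Then: (1) the space $\mathrm{LIP}(M)$ is dense in $(C(M),\tau)$, and (2) $ww(M)=d(C(M),\tau)=d(\mathrm{LIP}(M),\tau)\le d(M)$.
   Context: $C(M)$ is the set of all continuous real-valued functions on $M$; $\mathrm{LIP}(M)\subseteq C(M)$ is the vector space of all (not necessarily bounded) Lipschitz real-valued functions on $M$. $\tau_p$ is the topology of pointwise convergence on $C(M)$ (inherited from $\mathbb{R}^M$) and $\tau_k$ is the compact-open topology. A subset of $C(M)$ is endowed with the subspace topology, still denoted $\tau$. For a topological space $X$: $d(X)$ is the density (minimal cardinality of a dense subset), $w(X)$ is the weight (minimal cardinality of a base), and, for Tychonoff $X$, the weak weight $ww(X)$ is the minimal weight $w(Y)$ of a Tychonoff space $Y$ such that there exists a continuous bijection $\varphi\colon X\to Y$.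
   Formalization: Part (2) with literal minimal cardinalities fails for finite M (one point: ww(M)=d(M)=1 but d(C(M))=ℵ₀), so it is stated literally for infinite M, and for every M with each cardinal replaced by its maximum with ℵ₀. *)

theory Defs
  imports "HOL-Analysis.Analysis"
begin

unbundle cardinal_syntax

subsection \<open>Cardinal functions of topological spaces\<close>

text \<open>
  Cardinal numbers are the cardinal orders of the BNF cardinal library; they are compared with
  \<open>\<le>o\<close> and \<open>=o\<close>, which also relate cardinals living on different types.
  The cardinal functions below are the plain minima, so they can take finite values.  The usual
  convention in the theory of function spaces that cardinal invariants are infinite is obtained by
  adding \<open>natLeq\<close>, i.e. \<open>r +c natLeq\<close> is the maximum of \<open>r\<close> and aleph-zero.  Without it, the
  weak weight of a metric space \<open>M\<close> with \<open>n > 0\<close> points is \<open>n\<close>, whereas the space of continuous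
  functions on \<open>M\<close>, which is an \<open>n\<close>-dimensional real vector space, has infinite density.
\<close>

definition least_card :: "'b rel set \<Rightarrow> 'b rel"
  where "least_card R = (SOME r. r \<in> R \<and> (\<forall>s\<in>R. r \<le>o s))"

lemma least_card:
  assumes "R \<noteq> {}" and "\<And>r. r \<in> R \<Longrightarrow> Card_order r"
  shows "least_card R \<in> R" and "s \<in> R \<Longrightarrow> least_card R \<le>o s"
proof -
  have "\<exists>r. r \<in> R \<and> (\<forall>s\<in>R. r \<le>o s)"
    using exists_minim_Card_order[of R] assms by blast
  then have "least_card R \<in> R \<and> (\<forall>s\<in>R. least_card R \<le>o s)"
    unfolding least_card_def by (rule someI_ex)
  then show "least_card R \<in> R" and "s \<in> R \<Longrightarrow> least_card R \<le>o s"
    by auto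
qed

definition dense_in :: "'a topology \<Rightarrow> 'a set \<Rightarrow> bool"
  where "dense_in X D \<longleftrightarrow> D \<subseteq> topspace X \<and> X closure_of D = topspace X"

definition top_density :: "'a topology \<Rightarrow> 'a rel"
  where "top_density X = least_card {|D| | D. dense_in X D}"

definition base_of :: "'a topology \<Rightarrow> 'a set set \<Rightarrow> bool"
  where "base_of X \<B> \<longleftrightarrow>
    (\<forall>B\<in>\<B>. openin X B) \<and>
    (\<forall>U x. openin X U \<and> x \<in> U \<longrightarrow> (\<exists>B\<in>\<B>. x \<in> B \<and> B \<subseteq> U))"

definition weight :: "'a topology \<Rightarrow> 'a set rel"
  where "weight X = least_card {|\<B>| | \<B>. base_of X \<B>}"

definition Tychonoff_space :: "'a topology \<Rightarrow> bool"
  where "Tychonoff_space X \<longleftrightarrow> completely_regular_space X \<and> Hausdorff_space X"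

text \<open>
  The target space \<open>Y\<close> ranges over topologies on subsets of the type that carries \<open>X\<close>.  This loses
  no generality: a bijection \<open>\<phi>\<close> from \<open>X\<close> onto any space transports the topology of that space
  to the point set of \<open>X\<close>.  Only Tychonoff \<open>X\<close> are of interest; otherwise the set below may be
  empty and the value is unspecified.
\<close>

definition weak_weight :: "'a topology \<Rightarrow> 'a set rel"
  where "weak_weight X = least_card {weight Y | (Y :: 'a topology) \<phi>.
    Tychonoff_space Y \<and> continuous_map X Y \<phi> \<and> bij_betw \<phi> (topspace X) (topspace Y)}"

lemma top_density_wf: "{|D| | D. dense_in X D} \<noteq> {}" "r \<in> {|D| | D. dense_in X D} \<Longrightarrow> Card_order r"
proof -
  have "dense_in X (topspace X)"
    by (simp add: dense_in_def)
  then show "{|D| | D. dense_in X D} \<noteq> {}"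
    by blast
qed (use card_of_Card_order in blast)

lemma weight_wf: "{|\<B>| | \<B>. base_of X \<B>} \<noteq> {}" "s \<in> {|\<B>| | \<B>. base_of X \<B>} \<Longrightarrow> Card_order s"
proof -
  have "base_of X {U. openin X U}"
    by (auto simp: base_of_def)
  then show "{|\<B>| | \<B>. base_of X \<B>} \<noteq> {}"
    by blast
qed (use card_of_Card_order in blast)

lemma Card_order_weight: "Card_order (weight X)"
  unfolding weight_def by (rule weight_wf(2)[OF least_card(1)[OF weight_wf]])

lemma weak_weight_wf:
  fixes X :: "'a topology"
  defines "R \<equiv> {weight Y | (Y :: 'a topology) \<phi>.
    Tychonoff_space Y \<and> continuous_map X Y \<phi> \<and> bij_betw \<phi> (topspace X) (topspace Y)}"
  shows "Tychonoff_space X \<Longrightarrow> R \<noteq> {}" and "r \<in> R \<Longrightarrow> Card_order r"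
proof -
  assume "Tychonoff_space X"
  then have "weight X \<in> R"
    unfolding R_def mem_Collect_eq
    by (intro exI[of _ X] exI[of _ id]) simp
  then show "R \<noteq> {}"
    by (metis empty_iff)
next
  assume "r \<in> R"
  then obtain Y :: "'a topology" where "r = weight Y"
    unfolding R_def mem_Collect_eq by (elim exE conjE)
  then show "Card_order r"
    by (simp only: Card_order_weight)
qed

lemma Tychonoff_space_mtopology_of: "Tychonoff_space (mtopology_of M)"
  by (simp add: Tychonoff_space_def mtopology_of_def Metric_space.Hausdorff_space_mtopology
      Metric_space.metrizable_space_mtopology metrizable_imp_completely_regular_space)

subsection \<open>Function spaces over a metric space\<close>

text \<open>
  A real function on the carrier \<open>mspace M\<close> is represented by its unique extension that is
  \<open>undefined\<close> outside the carrier, as in the library's product topologies.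
\<close>

definition Cfun :: "'a metric \<Rightarrow> ('a \<Rightarrow> real) set"
  where "Cfun M = {f \<in> extensional (mspace M). continuous_map (mtopology_of M) euclideanreal f}"

definition LIP :: "'a metric \<Rightarrow> ('a \<Rightarrow> real) set"
  where "LIP M = {f \<in> extensional (mspace M). Lipschitz_continuous_map M euclidean_metric f}"

definition pointwise_topology :: "'a metric \<Rightarrow> ('a \<Rightarrow> real) topology"
  where "pointwise_topology M = subtopology (powertop_real (mspace M)) (Cfun M)"

definition compact_open_topology :: "'a metric \<Rightarrow> ('a \<Rightarrow> real) topology"
  where "compact_open_topology M = topology_generated_by
    {{f \<in> Cfun M. f ` K \<subseteq> U} | K U. compactin (mtopology_of M) K \<and> open U}"

lemma LIP_subset_Cfun: "LIP M \<subseteq> Cfun M"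
  using Lipschitz_continuous_imp_continuous_map[of M euclidean_metric]
  by (auto simp: LIP_def Cfun_def)

lemma topspace_pointwise_topology: "topspace (pointwise_topology M) = Cfun M"
  by (auto simp: pointwise_topology_def Cfun_def PiE_def)

lemma topspace_compact_open_topology: "topspace (compact_open_topology M) = Cfun M"
  unfolding compact_open_topology_def topology_generated_by_topspace
  by fastforce

end

theory Submission
  imports Defs
begin

text \<open>
  Write \<open>w\<close>, \<open>c\<close>, \<open>l\<close> and \<open>m\<close> for the weak weight of \<open>M\<close>, the densities of the continuous and of the
  Lipschitz functions under \<open>\<tau>\<close>, and the density of \<open>M\<close>.

  Every continuous \<open>f\<close> is a limit, uniformly on compact sets, of Lipschitz functions: truncate \<open>f\<close> to
  \<open>{-n..n}\<close> and take the largest minorant with Lipschitz constant \<open>n\<^sup>2\<close>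
  (\<open>lip_approx_converges\<close>).  Hence the Lipschitz functions are dense for the compact-open topology and
  for every coarser one, and \<open>c \<le> l\<close> since a dense subset of a dense subspace is dense.

  For \<open>l \<le> w\<close> let \<open>\<phi>\<close> be a continuous bijection of \<open>M\<close> onto a Tychonoff space of weight \<open>w\<close>.  Choosing
  one separating function for each suitable pair of base sets and closing their rational affine
  combinations under maxima and minima gives at most \<open>w\<close> (or countably) many continuous functions on
  \<open>M\<close>.  By the Kakutani-Stone argument they approximate every continuous function uniformly on compact sets
  (\<open>ex_approximating_family\<close>), and so do their countably many Lipschitz approximations.

  For \<open>w \<le> c\<close> take a dense set \<open>D\<close> of functions.  It separates the points of \<open>M\<close>, so the topology that
  it induces on \<open>M\<close> is Tychonoff, and preimages of rational intervals form a subbase of it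
  (\<open>weak_weight_le_function_density\<close>).

  Finally, \<open>w \<le> m\<close> because balls with rational radii around a dense set form a base of \<open>M\<close>.  Combined
  with \<open>l \<le> w\<close> this gives \<open>l \<le> m\<close>.

  These constructions absorb products with countable sets, so each inequality is proved in the form
  that every infinite cardinal bounding the right-hand side bounds the left-hand side.  The maximum
  of the right-hand side and aleph-zero is such a cardinal; if \<open>M\<close> is infinite, then all four
  cardinals are infinite and are themselves admissible bounds.
\<close>

section \<open>Cardinal bounds\<close>

text \<open>
  Dense families and bases are produced below by closing a set of generators under finitely many
  binary operations: pointwise maximum and minimum for functions, intersection for open sets.
\<close>

inductive_set binary_hull :: "('b \<Rightarrow> 'b \<Rightarrow> 'b) set \<Rightarrow> 'b set \<Rightarrow> 'b set"
  for H :: "('b \<Rightarrow> 'b \<Rightarrow> 'b) set" and S :: "'b set" where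
  base: "x \<in> S \<Longrightarrow> x \<in> binary_hull H S"
| step: "h \<in> H \<Longrightarrow> x \<in> binary_hull H S \<Longrightarrow> y \<in> binary_hull H S \<Longrightarrow> h x y \<in> binary_hull H S"

text \<open>
  The hull is exhausted by countably many stages.  Each stage adds the values of the operations on
  the previous one, and an infinite cardinal absorbs products and countable unions.
\<close>

lemma card_of_binary_hull:
  fixes r :: "'c rel"
  assumes r: "Cinfinite r" and H: "|H| \<le>o r" and S: "|S| \<le>o r"
  shows "|binary_hull H S| \<le>o r"
proof -
  define F :: "nat \<Rightarrow> 'a set" where
    "F = rec_nat S (\<lambda>_ T. T \<union> (\<lambda>(h, x, y). h x y) ` (H \<times> T \<times> T))"
  have F0: "F 0 = S" and FS: "F (Suc n) = F n \<union> (\<lambda>(h, x, y). h x y) ` (H \<times> F n \<times> F n)" for n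
    by (simp_all add: F_def)
  have inf: "infinite (Field r)" and co: "Card_order r"
    using r by (auto simp: cinfinite_def)
  have "|F n| \<le>o r" for n
  proof (induction n)
    case 0
    then show ?case by (simp add: F0 S)
  next
    case (Suc n)
    have "|H \<times> F n \<times> F n| \<le>o r"
      by (intro card_of_Times_ordLeq_infinite_Field inf H Suc co)
    then have "|(\<lambda>(h, x, y). h x y) ` (H \<times> F n \<times> F n)| \<le>o r"
      by (rule ordLeq_transitive[OF card_of_image])
    then show ?case
      unfolding FS by (intro card_of_Un_ordLeq_infinite_Field inf Suc co)
  qed
  moreover have "|UNIV :: nat set| \<le>o r"
    using inf infinite_iff_card_of_nat card_of_Field_ordIso[OF co] ordLeq_ordIso_trans by blast
  ultimately have "|\<Union>n. F n| \<le>o r"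
    by (intro card_of_UNION_ordLeq_infinite_Field inf co) auto
  moreover have "binary_hull H S \<subseteq> (\<Union>n. F n)"
  proof
    fix z
    assume "z \<in> binary_hull H S"
    then show "z \<in> (\<Union>n. F n)"
    proof induction
      case (base x)
      then show ?case using F0 by blast
    next
      case (step h x y)
      then obtain m n where "x \<in> F m" "y \<in> F n" by blast
      moreover have "F i \<subseteq> F (max m n)" if "i \<le> max m n" for i
        using that by (rule lift_Suc_mono_le[rotated]) (simp add: FS)
      ultimately have "x \<in> F (max m n)" "y \<in> F (max m n)"
        by (meson max.cobounded1 max.cobounded2 subsetD)+
      then have "h x y \<in> F (Suc (max m n))"
        unfolding FS using step by force
      then show ?case by blast
    qed
  qed
  ultimately show ?thesis
    using card_of_mono1 ordLeq_transitive by blast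
qed

lemma card_of_countable_ordLeq:
  assumes "Cinfinite r" and "countable A"
  shows "|A| \<le>o r"
proof -
  have "|A| \<le>o |UNIV :: nat set|"
    using assms(2) card_of_ordLeq[of A "UNIV :: nat set"] by (auto simp: countable_def)
  then have "|A| \<le>o natLeq"
    using card_of_nat ordLeq_ordIso_trans by blast
  then show ?thesis
    using assms(1) natLeq_ordLeq_cinfinite ordLeq_transitive by blast
qed

lemma Cinfinite_card_of:
  assumes "infinite A"
  shows "Cinfinite |A|"
proof
  show "cinfinite |A|"
    using assms by (simp add: cinfinite_def Field_card_of)
  show "Card_order |A|"
    by (rule card_of_Card_order)
qed

text \<open>
  Turns a comparison against all infinite cardinals into one of maxima with aleph-zero.
\<close>

lemma csum_natLeq_mono:
  assumes "Card_order p" and "Card_order s"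
    and "\<And>r :: ('b + nat) rel. Cinfinite r \<Longrightarrow> (s :: 'b rel) \<le>o r \<Longrightarrow> p \<le>o r"
  shows "p +c natLeq \<le>o s +c natLeq"
proof -
  have inf: "Cinfinite (s +c natLeq)"
    by (intro Cinfinite_csum disjI2 natLeq_Cinfinite)
  have "p \<le>o s +c natLeq"
    by (rule assms(3)[OF inf ordLeq_csum1[OF assms(2)]])
  then show ?thesis
    by (intro csum_cinfinite_bound ordLeq_csum2 natLeq_Card_order assms(1) inf)
qed

section \<open>Density, weight and weak weight\<close>

lemma dense_in_iff:
  "dense_in X D \<longleftrightarrow> D \<subseteq> topspace X \<and> (\<forall>U. openin X U \<and> U \<noteq> {} \<longrightarrow> D \<inter> U \<noteq> {})"
  unfolding dense_in_def
  by (auto simp: dense_intersects_open)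

lemma dense_in_subtopologyI:
  assumes "dense_in X D" and "D \<subseteq> S" and "S \<subseteq> topspace X"
  shows "dense_in (subtopology X S) D"
  using assms by (auto simp: dense_in_def closure_of_subtopology Int_absorb1)

lemma dense_in_trans:
  assumes "dense_in X S" and "dense_in (subtopology X S) D"
  shows "dense_in X D"
proof -
  have "D \<subseteq> S" "S \<subseteq> X closure_of D" "S \<subseteq> topspace X"
    using assms by (auto simp: dense_in_def closure_of_subtopology Int_absorb1 Int_absorb2)
  then show ?thesis
    using assms(1) unfolding dense_in_def
    by (metis closure_of_minimal closedin_closure_of closure_of_subset_topspace subset_antisym subset_trans)
qed

lemma top_density_le: "dense_in X D \<Longrightarrow> top_density X \<le>o |D|"
  unfolding top_density_def by (rule least_card(2)[OF top_density_wf]) auto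

lemma top_density_obtain:
  obtains D where "dense_in X D" and "top_density X = |D|"
proof -
  have "top_density X \<in> {|D| |D. dense_in X D}"
    unfolding top_density_def
    by (rule least_card(1)[OF top_density_wf(1)]) (erule top_density_wf(2))
  then show thesis
    using that by blast
qed

lemma weight_le: "base_of X B \<Longrightarrow> weight X \<le>o |B|"
  unfolding weight_def by (rule least_card(2)[OF weight_wf]) auto

lemma weight_obtain:
  obtains B where "base_of X B" and "weight X = |B|"
proof -
  have "weight X \<in> {|B| |B. base_of X B}"
    unfolding weight_def
    by (rule least_card(1)[OF weight_wf(1)]) (erule weight_wf(2))
  then show thesis
    using that by blast
qed

lemma weak_weight_le:
  fixes X Y :: "'a topology"
  assumes "Tychonoff_space X" "Tychonoff_space Y" "continuous_map X Y f"
    "bij_betw f (topspace X) (topspace Y)"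
  shows "weak_weight X \<le>o weight Y"
  unfolding weak_weight_def
proof (rule least_card(2)[OF weak_weight_wf])
  show "weight Y \<in> {weight Y |Y \<phi>. Tychonoff_space Y \<and> continuous_map X Y \<phi> \<and>
      bij_betw \<phi> (topspace X) (topspace Y)}"
    unfolding mem_Collect_eq using assms by (intro exI[of _ Y] exI[of _ f] conjI refl)
qed (use assms in simp_all)

lemma weak_weight_obtain:
  fixes X :: "'a topology"
  assumes "Tychonoff_space X"
  obtains Y :: "'a topology" and f where "Tychonoff_space Y" "continuous_map X Y f"
    "bij_betw f (topspace X) (topspace Y)" "weak_weight X = weight Y"
proof -
  have "weak_weight X \<in> {weight Y |Y \<phi>. Tychonoff_space Y \<and> continuous_map X Y \<phi> \<and>
      bij_betw \<phi> (topspace X) (topspace Y)}"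
    unfolding weak_weight_def
    by (rule least_card(1)[OF weak_weight_wf(1)[OF assms]]) (erule weak_weight_wf(2))
  then show thesis
    unfolding mem_Collect_eq by (elim exE conjE) (rule that)
qed

section \<open>Uniform approximation by lattices of functions\<close>

text \<open>
  One half of the Kakutani-Stone argument.  Each \<open>h\<close> of the hypothesis stays below \<open>f + e\<close> on an open
  neighbourhood of \<open>y\<close>; finitely many of these neighbourhoods cover \<open>K\<close>, and the minimum of the
  corresponding functions is below \<open>f + e\<close> on all of \<open>K\<close> without losing the lower bound on \<open>A\<close>.
\<close>

lemma min_lattice_compact:
  fixes L :: "('a \<Rightarrow> real) set"
  assumes K: "compactin X K"
    and cont: "\<And>h. h \<in> L \<Longrightarrow> continuous_map X euclideanreal h" "continuous_map X euclideanreal f"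
    and min: "\<And>g h. g \<in> L \<Longrightarrow> h \<in> L \<Longrightarrow> \<exists>k\<in>L. \<forall>x\<in>topspace X. k x = min (g x) (h x)"
    and "L \<noteq> {}" and A: "A \<subseteq> K"
    and ex: "\<And>y. y \<in> K \<Longrightarrow> \<exists>h\<in>L. h y < f y + e \<and> (\<forall>x\<in>A. f x - e < h x)"
  shows "\<exists>k\<in>L. (\<forall>y\<in>K. k y < f y + e) \<and> (\<forall>x\<in>A. f x - e < k x)"
proof (cases "K = {}")
  case True
  then show ?thesis using \<open>L \<noteq> {}\<close> A by auto
next
  case False
  have KX: "K \<subseteq> topspace X"
    using K compactin_subset_topspace by blast
  define L' where "L' = {h \<in> L. \<forall>x\<in>A. f x - e < h x}"
  define W where "W h = {z \<in> topspace X. h z - f z \<in> {..<e}}" for h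
  have "openin X (W h)" if "h \<in> L'" for h
    unfolding W_def using that cont
    by (intro openin_continuous_map_preimage[where Y = euclideanreal] continuous_intros) (auto simp: L'_def)
  moreover have "K \<subseteq> \<Union> (W ` L')"
  proof
    fix y assume "y \<in> K"
    with ex[of y] KX show "y \<in> \<Union> (W ` L')" unfolding L'_def W_def by fastforce
  qed
  ultimately obtain \<F> where "finite \<F>" "\<F> \<subseteq> W ` L'" "K \<subseteq> \<Union>\<F>"
    using compactinD[OF K, of "W ` L'"] by blast
  then obtain F where F: "finite F" "F \<subseteq> L'" "K \<subseteq> \<Union> (W ` F)"
    by (metis finite_subset_image)
  then have "F \<noteq> {}"
    using False by auto
  have "\<exists>k\<in>L'. \<forall>h\<in>F. \<forall>x\<in>K. k x \<le> h x"
    using F(1) \<open>F \<noteq> {}\<close> F(2)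
  proof (induction rule: finite_ne_induct)
    case (singleton h)
    then show ?case by auto
  next
    case (insert h F)
    then obtain k where k: "k \<in> L'" "\<forall>h\<in>F. \<forall>x\<in>K. k x \<le> h x" by auto
    with insert min[of h k] obtain l where l: "l \<in> L" "\<forall>x\<in>topspace X. l x = min (h x) (k x)"
      by (auto simp: L'_def)
    then have "l \<in> L'"
      using k insert A KX by (auto simp: L'_def subset_iff)
    moreover have "\<forall>h'\<in>insert h F. \<forall>x\<in>K. l x \<le> h' x"
      using l k KX by (fastforce simp: min_le_iff_disj)
    ultimately show ?case by blast
  qed
  then obtain k where k: "k \<in> L'" "\<And>h x. h \<in> F \<Longrightarrow> x \<in> K \<Longrightarrow> k x \<le> h x" by blast
  have "k y < f y + e" if "y \<in> K" for y
  proof -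
    obtain h where "h \<in> F" "y \<in> W h" using F(3) \<open>y \<in> K\<close> by blast
    then show ?thesis using k(2)[of h y] that by (auto simp: W_def)
  qed
  then show ?thesis
    using k(1) by (auto simp: L'_def)
qed

text \<open>
  The full argument applies the previous lemma twice: first with \<open>A = {x}\<close>, which yields for every
  \<open>x\<close> a function that is below \<open>f + e\<close> on \<open>K\<close> and above \<open>f - e\<close> at \<open>x\<close>; then to the negatives of
  these functions with \<open>A = K\<close>, which amounts to taking a finite maximum.
\<close>

lemma lattice_compact_approximation:
  fixes L :: "('a \<Rightarrow> real) set"
  assumes K: "compactin X K"
    and cont: "\<And>h. h \<in> L \<Longrightarrow> continuous_map X euclideanreal h" "continuous_map X euclideanreal f"
    and min: "\<And>g h. g \<in> L \<Longrightarrow> h \<in> L \<Longrightarrow> \<exists>k\<in>L. \<forall>x\<in>topspace X. k x = min (g x) (h x)"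
    and max: "\<And>g h. g \<in> L \<Longrightarrow> h \<in> L \<Longrightarrow> \<exists>k\<in>L. \<forall>x\<in>topspace X. k x = max (g x) (h x)"
    and "L \<noteq> {}"
    and ex: "\<And>x y. x \<in> K \<Longrightarrow> y \<in> K \<Longrightarrow> \<exists>h\<in>L. \<bar>h x - f x\<bar> < e \<and> \<bar>h y - f y\<bar> < e"
  shows "\<exists>k\<in>L. \<forall>x\<in>K. \<bar>k x - f x\<bar> < e"
proof -
  have below: "\<exists>k\<in>L. (\<forall>y\<in>K. k y < f y + e) \<and> (\<forall>z\<in>{x}. f z - e < k z)" if "x \<in> K" for x
  proof (rule min_lattice_compact[OF K cont min \<open>L \<noteq> {}\<close>])
    fix y assume "y \<in> K"
    with ex[OF that this] show "\<exists>h\<in>L. h y < f y + e \<and> (\<forall>x\<in>{x}. f x - e < h x)"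
      by (force simp: abs_less_iff)
  qed (use that in auto)
  let ?N = "(\<lambda>h x. - h x) ` L"
  have "\<exists>k\<in>?N. (\<forall>y\<in>K. k y < (\<lambda>x. - f x) y + e) \<and> (\<forall>x\<in>K. (\<lambda>x. - f x) x - e < k x)"
  proof (rule min_lattice_compact[OF K])
    fix g h assume "g \<in> ?N" "h \<in> ?N"
    then obtain g' h' where gh: "g' \<in> L" "h' \<in> L" "g = (\<lambda>x. - g' x)" "h = (\<lambda>x. - h' x)" by blast
    with max[of g' h'] obtain k where "k \<in> L" "\<forall>x\<in>topspace X. k x = max (g' x) (h' x)" by blast
    then show "\<exists>k\<in>?N. \<forall>x\<in>topspace X. k x = min (g x) (h x)"
      using gh by (intro bexI[of _ "\<lambda>x. - k x"]) auto
  next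
    fix y assume "y \<in> K"
    from below[OF this] show "\<exists>h\<in>?N. h y < (\<lambda>x. - f x) y + e \<and> (\<forall>x\<in>K. (\<lambda>x. - f x) x - e < h x)"
      by force
  qed (use cont \<open>L \<noteq> {}\<close> in \<open>auto intro!: continuous_intros\<close>)
  then show ?thesis
    by (force simp: abs_less_iff)
qed

section \<open>Uniform approximation on compact sets\<close>

lemma compact_image_Cfun:
  assumes "f \<in> Cfun M" and "compactin (mtopology_of M) K"
  shows "compact (f ` K)"
proof -
  have "compactin euclideanreal (f ` K)"
    using assms image_compactin[of "mtopology_of M" K euclideanreal f] by (simp add: Cfun_def)
  then show ?thesis by simp
qed

text \<open>
  Uniform closeness on a compact set controls the compact-open topology: if \<open>f\<close> maps \<open>K\<close> into an open
  \<open>V\<close>, then the compact set \<open>f ` K\<close> has positive distance from the complement of \<open>V\<close>.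
\<close>

lemma compact_open_neighbourhood:
  assumes "openin (compact_open_topology M) U" and "f \<in> U"
  shows "\<exists>K e. compactin (mtopology_of M) K \<and> e > 0 \<and>
    (\<forall>g\<in>Cfun M. (\<forall>x\<in>K. \<bar>g x - f x\<bar> < e) \<longrightarrow> g \<in> U)"
proof -
  have "generate_topology_on {{f \<in> Cfun M. f ` K \<subseteq> U} | K U. compactin (mtopology_of M) K \<and> open U} U"
    using assms(1) unfolding compact_open_topology_def by (rule openin_topology_generated_by)
  then show ?thesis
    using assms(2)
  proof (induction)
    case Empty
    then show ?case by simp
  next
    case (Int a b)
    then obtain K e L d where K: "compactin (mtopology_of M) K" "e > 0"
        "\<forall>g\<in>Cfun M. (\<forall>x\<in>K. \<bar>g x - f x\<bar> < e) \<longrightarrow> g \<in> a"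
      and L: "compactin (mtopology_of M) L" "d > 0"
        "\<forall>g\<in>Cfun M. (\<forall>x\<in>L. \<bar>g x - f x\<bar> < d) \<longrightarrow> g \<in> b"
      by blast
    then show ?case
      by (intro exI[of _ "K \<union> L"] exI[of _ "min e d"]) (auto intro: compactin_Un)
  next
    case (UN \<K>)
    then obtain k where "k \<in> \<K>" "f \<in> k" by blast
    with UN.IH[of k] show ?case by blast
  next
    case (Basis s)
    then obtain K V where s: "s = {f \<in> Cfun M. f ` K \<subseteq> V}" and K: "compactin (mtopology_of M) K"
      and "open V"
      by blast
    with Basis have f: "f \<in> Cfun M" "f ` K \<subseteq> V" by auto
    have "compact (f ` K)"
      using f(1) K by (rule compact_image_Cfun)
    then obtain e where "e > 0" and e: "(\<Union>y\<in>f ` K. ball y e) \<subseteq> V"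
      using compact_subset_open_imp_ball_epsilon_subset[OF _ \<open>open V\<close> f(2)] by blast
    have "g x \<in> V" if "\<forall>x\<in>K. \<bar>g x - f x\<bar> < e" "x \<in> K" for g :: "_ \<Rightarrow> real" and x
    proof -
      have "g x \<in> ball (f x) e"
        using that by (auto simp: dist_real_def abs_minus_commute)
      then show ?thesis using e that by blast
    qed
    then show ?case
      using K \<open>e > 0\<close> s by (intro exI[of _ K] exI[of _ e]) auto
  qed
qed

text \<open>
  Density for the topology of uniform convergence on compact sets.
\<close>

definition approximates_on_compacta :: "'a metric \<Rightarrow> ('a \<Rightarrow> real) set \<Rightarrow> bool"
  where "approximates_on_compacta M D \<longleftrightarrow>
    (\<forall>f\<in>Cfun M. \<forall>K e. compactin (mtopology_of M) K \<and> e > 0 \<longrightarrow>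
      (\<exists>g\<in>D. \<forall>x\<in>K. \<bar>g x - f x\<bar> < e))"

lemma approximates_on_compacta_imp_dense_in:
  assumes "topspace \<tau> = Cfun M"
    and "\<And>U. openin \<tau> U \<Longrightarrow> openin (compact_open_topology M) U"
    and "D \<subseteq> Cfun M" and "approximates_on_compacta M D"
  shows "dense_in \<tau> D"
  unfolding dense_in_iff
proof (intro conjI allI impI)
  fix U assume "openin \<tau> U \<and> U \<noteq> {}"
  then obtain f where "f \<in> U" "openin (compact_open_topology M) U" "f \<in> Cfun M"
    using assms(1,2) openin_subset by blast
  moreover from this obtain K e where "compactin (mtopology_of M) K" "e > 0"
    and Ke: "\<forall>g\<in>Cfun M. (\<forall>x\<in>K. \<bar>g x - f x\<bar> < e) \<longrightarrow> g \<in> U"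
    using compact_open_neighbourhood[of M U f] by blast
  ultimately obtain g where "g \<in> D" "\<forall>x\<in>K. \<bar>g x - f x\<bar> < e"
    using assms(4) unfolding approximates_on_compacta_def by blast
  then show "D \<inter> U \<noteq> {}"
    using Ke assms(3) by blast
qed (use assms in simp)

section \<open>Lipschitz approximation of continuous functions\<close>

text \<open>
  Compared with uniform continuity on \<open>K\<close>, only one of the two points has to lie in \<open>K\<close>.  This is
  what the approximation below needs, because its infimum ranges over the whole space.
\<close>

lemma uniformly_continuous_near_compact:
  assumes f: "f \<in> Cfun M" and K: "compactin (mtopology_of M) K" and "(e::real) > 0"
  shows "\<exists>d>0. \<forall>x\<in>K. \<forall>y\<in>mspace M. mdist M x y < d \<longrightarrow> \<bar>f y - f x\<bar> < e"
proof -
  interpret Metric_space "mspace M" "mdist M" by simp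
  have MK: "compactin mtopology K"
    using K by (simp add: mtopology_of_def)
  have KM: "K \<subseteq> mspace M"
    using K compactin_subset_topspace by fastforce
  have "\<exists>r>0. \<forall>y\<in>mspace M. mdist M x y < 2 * r \<longrightarrow> \<bar>f y - f x\<bar> < e / 2" if "x \<in> K" for x
  proof -
    have "openin mtopology {y \<in> topspace mtopology. f y \<in> ball (f x) (e/2)}"
      using f by (intro openin_continuous_map_preimage[where Y = euclideanreal])
        (auto simp: Cfun_def mtopology_of_def)
    moreover have "x \<in> {y \<in> topspace mtopology. f y \<in> ball (f x) (e/2)}"
      using that KM \<open>e > 0\<close> by auto
    ultimately obtain r where "r > 0" "mball x r \<subseteq> {y \<in> topspace mtopology. f y \<in> ball (f x) (e/2)}"
      unfolding openin_mtopology by blast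
    then show ?thesis
      using that KM
      by (intro exI[of _ "r/2"]) (auto simp: subset_iff dist_real_def abs_minus_commute)
  qed
  then obtain r where r: "\<And>x. x \<in> K \<Longrightarrow> r x > 0"
    "\<And>x y. x \<in> K \<Longrightarrow> y \<in> mspace M \<Longrightarrow> mdist M x y < 2 * r x \<Longrightarrow> \<bar>f y - f x\<bar> < e / 2"
    by metis
  have "\<exists>\<F>. finite \<F> \<and> \<F> \<subseteq> (\<lambda>x. mball x (r x)) ` K \<and> K \<subseteq> \<Union>\<F>"
  proof (rule compactinD[OF MK])
    show "K \<subseteq> \<Union> ((\<lambda>x. mball x (r x)) ` K)"
      using r(1) KM by force
  qed auto
  then obtain \<F> where \<F>: "finite \<F>" "\<F> \<subseteq> (\<lambda>x. mball x (r x)) ` K" "K \<subseteq> \<Union>\<F>"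
    by blast
  obtain F where F: "finite F" "F \<subseteq> K" "K \<subseteq> (\<Union>x\<in>F. mball x (r x))"
    using finite_subset_image[OF \<F>(1,2)] \<F>(3) by blast
  define d where "d = Min (insert 1 (r ` F))"
  have "d > 0"
    unfolding d_def using F r(1) by (subst Min_gr_iff) auto
  moreover have "\<bar>f y - f x\<bar> < e" if "x \<in> K" "y \<in> mspace M" "mdist M x y < d" for x y
  proof -
    obtain z where z: "z \<in> F" "x \<in> mball z (r z)"
      using F(3) \<open>x \<in> K\<close> by blast
    then have zx: "mdist M z x < r z" "z \<in> mspace M" "z \<in> K" "x \<in> mspace M"
      using F(2) by auto
    have "d \<le> r z"
      unfolding d_def using F(1) z(1) by (intro Min_le) auto
    then have zy: "mdist M z y < 2 * r z"
      using triangle[of z x y] zx that by linarith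
    have "\<bar>f x - f z\<bar> < e / 2" "\<bar>f y - f z\<bar> < e / 2"
      using r(2)[of z x] r(2)[of z y] zx zy that nonneg[of z x] by linarith+
    then show ?thesis by linarith
  qed
  ultimately show ?thesis by blast
qed

text \<open>
  The Pasch-Hausdorff envelope (infimal convolution with a multiple of the distance) of \<open>f\<close> truncated
  to \<open>{-n..n}\<close>, with Lipschitz constant \<open>n\<^sup>2\<close>.  The truncation makes the infimum finite.  The constant
  is quadratic so that it dominates the truncation level: at a fixed positive distance \<open>d\<close> the
  penalty \<open>n\<^sup>2 * d\<close> eventually exceeds \<open>2 * n\<close>.
\<close>

definition lip_approx :: "'a metric \<Rightarrow> nat \<Rightarrow> ('a \<Rightarrow> real) \<Rightarrow> 'a \<Rightarrow> real"
  where "lip_approx M n f = (\<lambda>x\<in>mspace M.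
    INF y\<in>mspace M. max (- real n) (min (real n) (f y)) + (real n)\<^sup>2 * mdist M x y)"

lemma lip_approx_le:
  assumes "x \<in> mspace M" "y \<in> mspace M"
  shows "lip_approx M n f x \<le> max (- real n) (min (real n) (f y)) + (real n)\<^sup>2 * mdist M x y"
proof -
  have "bdd_below ((\<lambda>y. max (- real n) (min (real n) (f y)) + (real n)\<^sup>2 * mdist M x y) ` mspace M)"
  proof (rule bdd_belowI2)
    fix y
    show "- real n \<le> max (- real n) (min (real n) (f y)) + (real n)\<^sup>2 * mdist M x y"
      by (simp add: add_increasing2)
  qed
  then show ?thesis
    using assms cINF_lower[of _ "mspace M" y] by (simp add: lip_approx_def)
qed

lemma le_lip_approx:
  assumes "x \<in> mspace M"
    and "\<And>y. y \<in> mspace M \<Longrightarrow> c \<le> max (- real n) (min (real n) (f y)) + (real n)\<^sup>2 * mdist M x y"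
  shows "c \<le> lip_approx M n f x"
  using assms by (auto simp: lip_approx_def intro!: cINF_greatest)

text \<open>
  An infimum of functions of \<open>x\<close> that share the Lipschitz constant \<open>n\<^sup>2\<close> has that constant too.
\<close>

lemma lip_approx_in_LIP: "lip_approx M n f \<in> LIP M"
proof -
  have *: "lip_approx M n f x \<le> lip_approx M n f z + (real n)\<^sup>2 * mdist M x z"
    if "x \<in> mspace M" "z \<in> mspace M" for x z
  proof -
    have "lip_approx M n f x - (real n)\<^sup>2 * mdist M x z \<le> lip_approx M n f z"
    proof (rule le_lip_approx[OF that(2)])
      fix y assume y: "y \<in> mspace M"
      have "(real n)\<^sup>2 * mdist M x y \<le> (real n)\<^sup>2 * (mdist M x z + mdist M z y)"
        using that y by (intro mult_left_mono) (auto simp: mdist_triangle)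
      then show "lip_approx M n f x - (real n)\<^sup>2 * mdist M x z
          \<le> max (- real n) (min (real n) (f y)) + (real n)\<^sup>2 * mdist M z y"
        using lip_approx_le[OF that(1) y, of n f] by (simp add: distrib_left)
    qed
    then show ?thesis by simp
  qed
  have "dist (lip_approx M n f x) (lip_approx M n f z) \<le> (real n)\<^sup>2 * mdist M x z"
    if "x \<in> mspace M" "z \<in> mspace M" for x z
    using *[OF that] *[OF that(2,1)] by (simp add: dist_real_def abs_le_iff mdist_commute)
  then show ?thesis
    unfolding LIP_def Lipschitz_continuous_map_def
    by (auto simp: lip_approx_def[abs_def] restrict_def extensional_def)
qed

text \<open>
  On \<open>K\<close> the envelope is at most \<open>f\<close> once \<open>n\<close> bounds \<open>\<bar>f\<bar>\<close> there.  It is not much smaller: points near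
  \<open>x\<close> have values close to \<open>f x\<close>, and for the other points the penalty outweighs the truncated value.
\<close>

lemma lip_approx_converges:
  assumes f: "f \<in> Cfun M" and K: "compactin (mtopology_of M) K" and "(e::real) > 0"
  shows "\<exists>n. \<forall>x\<in>K. \<bar>lip_approx M n f x - f x\<bar> < e"
proof -
  obtain d where "d > 0"
    and d: "\<And>x y. x \<in> K \<Longrightarrow> y \<in> mspace M \<Longrightarrow> mdist M x y < d \<Longrightarrow> \<bar>f y - f x\<bar> < e / 2"
    using uniformly_continuous_near_compact[OF f K, of "e/2"] \<open>e > 0\<close> by auto
  have KM: "K \<subseteq> mspace M"
    using K compactin_subset_topspace by fastforce
  have "bounded (f ` K)"
    using compact_image_Cfun[OF f K] by (rule compact_imp_bounded)
  then obtain B where B: "\<And>x. x \<in> K \<Longrightarrow> \<bar>f x\<bar> \<le> B"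
    by (auto simp: bounded_real)
  \<comment> \<open>The bound \<open>2 / d\<close> gives \<open>n\<^sup>2 * d - n \<ge> n \<ge> f x\<close> for the points at distance at least \<open>d\<close>.\<close>
  obtain n :: nat where n: "real n \<ge> max B (2 / d)"
    using real_arch_simple by blast
  then have nd: "real n * d \<ge> 2" and nB: "real n \<ge> B"
    using \<open>d > 0\<close> by (auto simp: field_simps)
  have "\<bar>lip_approx M n f x - f x\<bar> < e" if x: "x \<in> K" for x
  proof -
    have xM: "x \<in> mspace M" using x KM by blast
    have fx: "- real n \<le> f x" "f x \<le> real n"
      using B[OF x] nB by auto
    have "lip_approx M n f x \<le> f x"
      using lip_approx_le[OF xM xM, of n f] fx mdist_zero[OF xM xM] by simp
    moreover have "f x - e / 2 \<le> lip_approx M n f x"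
    proof (rule le_lip_approx[OF xM])
      fix y assume y: "y \<in> mspace M"
      show "f x - e / 2 \<le> max (- real n) (min (real n) (f y)) + (real n)\<^sup>2 * mdist M x y"
      proof (cases "mdist M x y < d")
        case True
        have "(real n)\<^sup>2 * mdist M x y \<ge> 0" by simp
        with d[OF x y True] fx \<open>e > 0\<close> show ?thesis by linarith
      next
        case False
        have "real n * 2 \<le> real n * (real n * d)"
          using nd by (intro mult_left_mono) auto
        also have "\<dots> \<le> (real n)\<^sup>2 * mdist M x y"
          using False by (simp add: power2_eq_square mult_left_mono mult.assoc)
        finally show ?thesis
          using fx \<open>e > 0\<close> by linarith
      qed
    qed
    ultimately show ?thesis using \<open>e > 0\<close> by linarith
  qed
  then show ?thesis by blast
qed

text \<open>
  Replacing every member of an approximating family by its countably many envelopes yields Lipschitz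
  functions and does not raise an infinite cardinality.  This is why the Lipschitz functions have no
  larger density than all continuous functions, although density need not pass to subspaces.
\<close>

lemma lip_approx_approximates:
  assumes "D \<subseteq> Cfun M" and "approximates_on_compacta M D"
  shows "approximates_on_compacta M (\<Union>n. lip_approx M n ` D)"
  unfolding approximates_on_compacta_def
proof (intro ballI allI impI, elim conjE)
  fix f K and e :: real
  assume f: "f \<in> Cfun M" and K: "compactin (mtopology_of M) K" and e: "e > 0"
  then obtain g where g: "g \<in> D" "\<forall>x\<in>K. \<bar>g x - f x\<bar> < e / 2"
    using assms(2) half_gt_zero[OF e] unfolding approximates_on_compacta_def by blast
  with assms(1) lip_approx_converges[OF _ K half_gt_zero[OF e]] obtain n
    where n: "\<forall>x\<in>K. \<bar>lip_approx M n g x - g x\<bar> < e / 2"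
    by blast
  have "\<forall>x\<in>K. \<bar>lip_approx M n g x - f x\<bar> < e"
  proof
    fix x assume "x \<in> K"
    with n g(2) have "\<bar>lip_approx M n g x - g x\<bar> < e / 2" "\<bar>g x - f x\<bar> < e / 2" by auto
    then show "\<bar>lip_approx M n g x - f x\<bar> < e" by linarith
  qed
  with g(1) show "\<exists>h\<in>\<Union>n. lip_approx M n ` D. \<forall>x\<in>K. \<bar>h x - f x\<bar> < e" by blast
qed

section \<open>Small dense families from a coarser Tychonoff topology\<close>

lemma rat_near:
  fixes a e :: real
  assumes "e > 0"
  shows "\<exists>p. \<bar>of_rat p - a\<bar> < e"
proof -
  obtain p where "a - e < of_rat p" "of_rat p < a + e"
    using of_rat_dense[of "a - e" "a + e"] assms by auto
  then show ?thesis
    by (intro exI[of _ p]) (simp add: abs_less_iff)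
qed

text \<open>
  Complete regularity gives a function that vanishes at \<open>x\<close> and is 1 off \<open>V\<close>.  It is sharpened to
  vanish on a base set around \<open>x\<close>, so that one function per pair of base sets is enough to separate
  all pairs of points.
\<close>

lemma base_of_Tychonoff_separates:
  assumes Y: "Tychonoff_space Y" and B: "base_of Y B"
    and xy: "x \<in> topspace Y" "y \<in> topspace Y" "x \<noteq> y"
  shows "\<exists>U\<in>B. \<exists>V\<in>B. x \<in> U \<and> y \<notin> V \<and>
    (\<exists>g. continuous_map Y euclideanreal g \<and> g ` U \<subseteq> {0} \<and> g ` (topspace Y - V) \<subseteq> {1})"
proof -
  obtain W where "openin Y W" "x \<in> W" "y \<notin> W"
    using Y xy unfolding Tychonoff_space_def Hausdorff_space_def disjnt_iff by meson
  then obtain V where V: "V \<in> B" "x \<in> V" "y \<notin> V" "openin Y V"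
    using B unfolding base_of_def by (meson subsetD)
  then obtain h where h: "continuous_map Y euclideanreal h" "h x = 0" "h ` (topspace Y - V) \<subseteq> {1}"
    using Y unfolding Tychonoff_space_def completely_regular_space_alt' by meson
  have "openin Y {z \<in> topspace Y. h z \<in> {..<1/2}}"
    using h(1) by (rule openin_continuous_map_preimage) auto
  moreover have "x \<in> {z \<in> topspace Y. h z \<in> {..<1/2}}"
    using h(2) xy by simp
  ultimately obtain U where U: "U \<in> B" "x \<in> U" "U \<subseteq> {z \<in> topspace Y. h z \<in> {..<1/2}}"
    using B unfolding base_of_def by meson
  have "continuous_map Y euclideanreal (\<lambda>z. max 0 (2 * h z - 1))"
    using h(1) by (intro continuous_intros) auto
  moreover have "(\<lambda>z. max 0 (2 * h z - 1)) ` U \<subseteq> {0}"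
    using U(3) by auto
  moreover have "(\<lambda>z. max 0 (2 * h z - 1)) ` (topspace Y - V) \<subseteq> {1}"
    using h(3) by auto
  ultimately show ?thesis
    using U V by blast
qed

lemma restrict_in_Cfun:
  assumes "continuous_map (mtopology_of M) euclideanreal f"
  shows "restrict f (mspace M) \<in> Cfun M"
proof -
  have "continuous_map (mtopology_of M) euclideanreal (restrict f (mspace M))"
    using assms by (rule continuous_map_eq) simp
  then show ?thesis
    unfolding Cfun_def by simp
qed

text \<open>
  Pulled back along \<open>\<phi>\<close>, the functions attached to pairs of base sets separate the points of \<open>M\<close>.
  Rational affine combinations of each of them with the constants take nearly prescribed values at
  any two points, so the lattice they generate is uniformly dense on compact sets.
\<close>

lemma ex_approximating_family:
  fixes M :: "'a metric" and Y :: "'b topology" and r :: "'c rel"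
  assumes Y: "Tychonoff_space Y" and B: "base_of Y B"
    and \<phi>: "continuous_map (mtopology_of M) Y \<phi>" "inj_on \<phi> (mspace M)"
    and r: "Cinfinite r" and Br: "|B| \<le>o r"
  shows "\<exists>L. L \<subseteq> Cfun M \<and> approximates_on_compacta M L \<and> |L| \<le>o r"
proof -
  have inf: "infinite (Field r)" and co: "Card_order r"
    using r by (auto simp: cinfinite_def)
  define Q where "Q U V g \<longleftrightarrow> continuous_map Y euclideanreal g \<and>
    g ` U \<subseteq> {0} \<and> g ` (topspace Y - V) \<subseteq> {1::real}" for U V g
  define s where "s U V = (SOME g. Q U V g)" for U V
  \<comment> \<open>A function is chosen only for the pairs of base sets that admit one.\<close>
  define P where "P = {(U, V) \<in> B \<times> B. \<exists>g. Q U V g}"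
  have s: "Q U V (s U V)" if "(U, V) \<in> P" for U V
  proof -
    have "\<exists>g. Q U V g"
      using that by (auto simp: P_def)
    then show ?thesis
      unfolding s_def by (rule someI_ex)
  qed
  define affine where "affine = (\<lambda>(p::rat, q::rat, U, V). \<lambda>x\<in>mspace M. of_rat p + of_rat q * s U V (\<phi> x))"
  \<comment> \<open>The constants serve the case of equal points and keep the family nonempty when \<open>M\<close> is empty.\<close>
  define G where "G = range (\<lambda>p::rat. \<lambda>x\<in>mspace M. of_rat p :: real) \<union> affine ` (UNIV \<times> UNIV \<times> P)"
  define lmax :: "('a \<Rightarrow> real) \<Rightarrow> _" where "lmax = (\<lambda>g h. \<lambda>x\<in>mspace M. max (g x) (h x))"
  define lmin :: "('a \<Rightarrow> real) \<Rightarrow> _" where "lmin = (\<lambda>g h. \<lambda>x\<in>mspace M. min (g x) (h x))"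
  define L where "L = binary_hull {lmax, lmin} G"
  have rat: "|UNIV :: rat set| \<le>o r"
    using r by (intro card_of_countable_ordLeq) auto
  have "|P| \<le>o r"
    using card_of_mono1[of P "B \<times> B"] card_of_Times_ordLeq_infinite_Field[OF inf Br Br co]
    by (auto simp: P_def intro: ordLeq_transitive)
  then have "|UNIV \<times> UNIV \<times> P :: (rat \<times> rat \<times> 'b set \<times> 'b set) set| \<le>o r"
    by (intro card_of_Times_ordLeq_infinite_Field inf rat co)
  then have "|G| \<le>o r"
    unfolding G_def using rat
    by (intro card_of_Un_ordLeq_infinite_Field inf co ordLeq_transitive[OF card_of_image])
  moreover have "|{lmax, lmin}| \<le>o r"
    using r by (intro card_of_countable_ordLeq) auto
  ultimately have "|L| \<le>o r"
    unfolding L_def using r by (intro card_of_binary_hull)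
  moreover have LC: "L \<subseteq> Cfun M"
  proof
    fix f assume "f \<in> L"
    then show "f \<in> Cfun M"
      unfolding L_def
    proof induction
      case (base f)
      show ?case
      proof (cases "f \<in> affine ` (UNIV \<times> UNIV \<times> P)")
        case True
        then obtain p q U V where f: "f = affine (p, q, U, V)" and "(U, V) \<in> P" by auto
        then have "continuous_map (mtopology_of M) euclideanreal (\<lambda>x. s U V (\<phi> x))"
          using s[of U V] \<phi>(1) continuous_map_compose[of "mtopology_of M" Y \<phi> euclideanreal "s U V"]
          by (simp add: Q_def o_def)
        then have "continuous_map (mtopology_of M) euclideanreal (\<lambda>x. of_rat p + of_rat q * s U V (\<phi> x))"
          by (intro continuous_intros) auto
        then have "(\<lambda>x\<in>mspace M. of_rat p + of_rat q * s U V (\<phi> x)) \<in> Cfun M"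
          by (rule restrict_in_Cfun)
        then show ?thesis
          unfolding f affine_def prod.case .
      next
        case False
        then obtain p :: rat where f: "f = (\<lambda>x\<in>mspace M. of_rat p)"
          using base by (auto simp: G_def)
        show ?thesis
          unfolding f by (rule restrict_in_Cfun) simp
      qed
    next
      case (step h f g)
      then have "continuous_map (mtopology_of M) euclideanreal (\<lambda>x. max (f x) (g x))"
        "continuous_map (mtopology_of M) euclideanreal (\<lambda>x. min (f x) (g x))"
        by (auto simp: Cfun_def intro!: continuous_intros)
      then have "lmax f g \<in> Cfun M" "lmin f g \<in> Cfun M"
        unfolding lmax_def lmin_def by (simp_all only: restrict_in_Cfun)
      with step(1) show ?case by blast
    qed
  qed
  moreover have "approximates_on_compacta M L"
    unfolding approximates_on_compacta_def
  proof (intro ballI allI impI, elim conjE)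
    fix f K and e :: real
    assume f: "f \<in> Cfun M" and K: "compactin (mtopology_of M) K" and "e > 0"
    have GL: "G \<subseteq> L"
      unfolding L_def by (auto intro: binary_hull.base)
    have KM: "K \<subseteq> mspace M"
      using K compactin_subset_topspace by fastforce
    show "\<exists>g\<in>L. \<forall>x\<in>K. \<bar>g x - f x\<bar> < e"
    proof (rule lattice_compact_approximation[OF K])
      fix g h assume "g \<in> L" "h \<in> L"
      then have "lmax g h \<in> L" "lmin g h \<in> L"
        unfolding L_def by (auto intro: binary_hull.step)
      then show "\<exists>k\<in>L. \<forall>x\<in>topspace (mtopology_of M). k x = min (g x) (h x)"
        and "\<exists>k\<in>L. \<forall>x\<in>topspace (mtopology_of M). k x = max (g x) (h x)"
        by (auto simp: lmax_def lmin_def intro: bexI[of _ "lmin g h"] bexI[of _ "lmax g h"])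
    next
      show "L \<noteq> {}"
        using GL by (auto simp: G_def)
    next
      fix x y assume x: "x \<in> K" and y: "y \<in> K"
      \<comment> \<open>The function \<open>p + (t - p) * s\<close> takes the value \<open>p\<close> at \<open>x\<close> and \<open>t\<close> at \<open>y\<close>.\<close>
      obtain p t where p: "\<bar>of_rat p - f x\<bar> < e" and t: "\<bar>of_rat t - f y\<bar> < e"
        using rat_near[OF \<open>e > 0\<close>] by metis
      show "\<exists>h\<in>L. \<bar>h x - f x\<bar> < e \<and> \<bar>h y - f y\<bar> < e"
      proof (cases "x = y")
        case True
        then show ?thesis
          using p x KM GL by (intro bexI[of _ "\<lambda>x\<in>mspace M. of_rat p"]) (auto simp: G_def)
      next
        case False
        have xy: "x \<in> mspace M" "y \<in> mspace M"
          using x y KM by auto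
        then have "\<phi> x \<noteq> \<phi> y" "\<phi> x \<in> topspace Y" "\<phi> y \<in> topspace Y"
          using False \<phi> by (auto simp: inj_on_def continuous_map_def Pi_iff)
        then obtain U V where "(U, V) \<in> P" "\<phi> x \<in> U" "\<phi> y \<in> topspace Y - V"
          using base_of_Tychonoff_separates[OF Y B, of "\<phi> x" "\<phi> y"] unfolding P_def Q_def by blast
        with s[of U V] have "s U V (\<phi> x) = 0" "s U V (\<phi> y) = 1"
          unfolding Q_def by blast+
        then have "affine (p, t - p, U, V) x = of_rat p" "affine (p, t - p, U, V) y = of_rat t"
          using xy by (auto simp: affine_def of_rat_diff)
        moreover have "affine (p, t - p, U, V) \<in> L"
          using GL \<open>(U, V) \<in> P\<close> by (auto simp: G_def)
        ultimately show ?thesis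
          using p t by metis
      qed
    qed (use LC f in \<open>auto simp: Cfun_def\<close>)
  qed
  ultimately show ?thesis by blast
qed

text \<open>
  The countably many envelopes of each member of the approximating family stay within the infinite
  bound \<open>r\<close>.  They are dense among all continuous functions for the compact-open topology, hence for
  the coarser \<open>\<tau>\<close>, and being Lipschitz they are dense in the subspace too.
\<close>

lemma LIP_density_le_weak_weight:
  assumes "topspace \<tau> = Cfun M"
    and "\<And>U. openin \<tau> U \<Longrightarrow> openin (compact_open_topology M) U"
    and r: "Cinfinite r" and "weak_weight (mtopology_of M) \<le>o r"
  shows "top_density (subtopology \<tau> (LIP M)) \<le>o r"
proof -
  obtain Y :: "'a topology" and \<phi> where Y: "Tychonoff_space Y"
    and \<phi>: "continuous_map (mtopology_of M) Y \<phi>" "bij_betw \<phi> (topspace (mtopology_of M)) (topspace Y)"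
    and w: "weak_weight (mtopology_of M) = weight Y"
    by (rule weak_weight_obtain[OF Tychonoff_space_mtopology_of])
  obtain B where B: "base_of Y B" "weight Y = |B|"
    by (rule weight_obtain)
  obtain L where L: "L \<subseteq> Cfun M" "approximates_on_compacta M L" "|L| \<le>o r"
    using ex_approximating_family[OF Y B(1) \<phi>(1) _ r] assms(4) \<phi>(2) w B(2)
    by (auto simp: bij_betw_def)
  define E where "E = (\<Union>n. lip_approx M n ` L)"
  have inf: "infinite (Field r)" and co: "Card_order r"
    using r by (auto simp: cinfinite_def)
  have "|UNIV :: nat set| \<le>o r"
    using r by (intro card_of_countable_ordLeq) auto
  then have "|E| \<le>o r"
    unfolding E_def using L(3)
    by (intro card_of_UNION_ordLeq_infinite_Field inf co ballI
        ordLeq_transitive[OF card_of_image]) auto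
  have "E \<subseteq> LIP M"
    using lip_approx_in_LIP by (auto simp: E_def)
  have "dense_in \<tau> E"
    using \<open>E \<subseteq> LIP M\<close> LIP_subset_Cfun lip_approx_approximates[OF L(1,2)]
    by (intro approximates_on_compacta_imp_dense_in[OF assms(1,2)]) (auto simp: E_def)
  then have "dense_in (subtopology \<tau> (LIP M)) E"
    using \<open>E \<subseteq> LIP M\<close> LIP_subset_Cfun assms(1) by (intro dense_in_subtopologyI) auto
  then show ?thesis
    using top_density_le \<open>|E| \<le>o r\<close> ordLeq_transitive by blast
qed

lemma LIP_dense:
  assumes "topspace \<tau> = Cfun M"
    and "\<And>U. openin \<tau> U \<Longrightarrow> openin (compact_open_topology M) U"
  shows "dense_in \<tau> (LIP M)"
proof (rule approximates_on_compacta_imp_dense_in[OF assms LIP_subset_Cfun])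
  show "approximates_on_compacta M (LIP M)"
    unfolding approximates_on_compacta_def
    using lip_approx_converges lip_approx_in_LIP by blast
qed

lemma density_le_density_of_dense:
  assumes "dense_in X S"
  shows "top_density X \<le>o top_density (subtopology X S)"
proof -
  obtain D where "dense_in (subtopology X S) D" "top_density (subtopology X S) = |D|"
    by (rule top_density_obtain)
  then show ?thesis
    using dense_in_trans[OF assms] top_density_le by metis
qed

section \<open>Weight of a metric space\<close>

lemma weight_metric_le:
  assumes D: "dense_in (mtopology_of M) D" and r: "Cinfinite r" and Dr: "|D| \<le>o r"
  shows "weight (mtopology_of M) \<le>o r"
proof -
  interpret Metric_space "mspace M" "mdist M" by simp
  have mt: "mtopology_of M = mtopology"
    by (simp add: mtopology_of_def)
  define B where "B = (\<lambda>(x, q::rat). mball x (of_rat q)) ` (D \<times> UNIV)"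
  have "base_of (mtopology_of M) B"
    unfolding base_of_def mt
  proof (intro conjI ballI allI impI, goal_cases)
    case (1 b)
    then show ?case by (auto simp: B_def)
  next
    case (2 U x)
    then obtain e where "e > 0" and e: "mball x e \<subseteq> U" and x: "x \<in> mspace M"
      unfolding openin_mtopology by blast
    obtain q :: rat where q: "0 < real_of_rat q" "real_of_rat q < e / 2"
      using of_rat_dense[of 0 "e/2"] \<open>e > 0\<close> by auto
    have "openin mtopology (mball x (of_rat q))" "mball x (of_rat q) \<noteq> {}"
      using x q centre_in_mball_iff[of x "of_rat q"] by (simp, fastforce)
    then obtain d where d: "d \<in> D" "d \<in> mball x (of_rat q)"
      using D unfolding dense_in_iff mt by blast
    have "y \<in> mball x e" if "y \<in> mball d (of_rat q)" for y
      using that d q triangle[of x d y] by auto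
    moreover have "x \<in> mball d (of_rat q)"
      using d by (auto simp: commute)
    ultimately show ?case
      using d(1) e by (intro bexI[of _ "mball d (of_rat q)"]) (auto simp: B_def)
  qed
  moreover have "|UNIV :: rat set| \<le>o r"
    using r by (intro card_of_countable_ordLeq) auto
  then have "|B| \<le>o r"
    unfolding B_def using r Dr
    by (intro ordLeq_transitive[OF card_of_image] card_of_Times_ordLeq_infinite_Field)
      (auto simp: cinfinite_def)
  ultimately show ?thesis
    using weight_le ordLeq_transitive by blast
qed

lemma weak_weight_le_density:
  assumes r: "Cinfinite r" and "top_density (mtopology_of M) \<le>o r"
  shows "weak_weight (mtopology_of M) \<le>o r"
proof -
  obtain D where D: "dense_in (mtopology_of M) D" "top_density (mtopology_of M) = |D|"
    by (rule top_density_obtain)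
  have "weak_weight (mtopology_of M) \<le>o weight (mtopology_of M)"
    by (rule weak_weight_le[where f = id]) (simp_all add: Tychonoff_space_mtopology_of)
  then show ?thesis
    using weight_metric_le[OF D(1) r] D(2) assms(2) ordLeq_transitive by metis
qed

section \<open>The topology induced by a family of functions\<close>

lemma Tychonoff_space_pullback:
  assumes "Tychonoff_space Z" and "inj_on F S" and FS: "F ` S \<subseteq> topspace Z"
  shows "Tychonoff_space (pullback_topology S F Z)"
  unfolding Tychonoff_space_def
proof
  let ?Y = "pullback_topology S F Z"
  have S: "topspace ?Y = S"
    using FS by (auto simp: topspace_pullback_topology)
  show "completely_regular_space ?Y"
    unfolding completely_regular_space_alt'
  proof (intro allI impI)
    fix U x assume "openin ?Y U" and x: "x \<in> U"
    then obtain V where V: "openin Z V" "U = F -` V \<inter> S"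
      unfolding openin_pullback_topology by blast
    then obtain g where g: "continuous_map Z euclideanreal g" "g (F x) = 0" "g ` (topspace Z - V) \<subseteq> {1}"
      using assms(1) x unfolding Tychonoff_space_def completely_regular_space_alt'
      by (metis IntD1 vimage_eq)
    have "continuous_map ?Y euclideanreal (g \<circ> F)"
      using g(1) by (rule continuous_map_pullback)
    moreover have "(g \<circ> F) ` (topspace ?Y - U) \<subseteq> {1}"
      using g(3) V(2) FS by (auto simp: S image_subset_iff)
    ultimately show "\<exists>f. continuous_map ?Y euclideanreal f \<and> f x = 0 \<and> f ` (topspace ?Y - U) \<subseteq> {1}"
      using g(2) by (intro exI[of _ "g \<circ> F"]) auto
  qed
  show "Hausdorff_space ?Y"
    unfolding Hausdorff_space_def S
  proof (intro allI impI, elim conjE)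
    fix x y assume xy: "x \<in> S" "y \<in> S" "x \<noteq> y"
    then have "F x \<noteq> F y" "F x \<in> topspace Z" "F y \<in> topspace Z"
      using assms(2) FS by (auto simp: inj_on_def)
    then obtain U V where UV: "openin Z U" "openin Z V" "F x \<in> U" "F y \<in> V" "disjnt U V"
      using assms(1) unfolding Tychonoff_space_def Hausdorff_space_def by meson
    show "\<exists>U V. openin ?Y U \<and> openin ?Y V \<and> x \<in> U \<and> y \<in> V \<and> disjnt U V"
    proof (intro exI conjI)
      show "openin ?Y (F -` U \<inter> S)" "openin ?Y (F -` V \<inter> S)"
        using UV(1,2) unfolding openin_pullback_topology by blast+
    qed (use UV(3-5) xy in \<open>auto simp: disjnt_iff\<close>)
  qed
qed

text \<open>
  The coarsest topology on \<open>S\<close> that makes all members of \<open>D\<close> continuous, obtained from the evaluation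
  map of \<open>S\<close> into the power of the real line with exponents \<open>D\<close>.
\<close>

definition initial_topology :: "'a set \<Rightarrow> ('a \<Rightarrow> real) set \<Rightarrow> 'a topology"
  where "initial_topology S D = pullback_topology S (\<lambda>x. \<lambda>f\<in>D. f x) (powertop_real D)"

lemma topspace_initial_topology [simp]: "topspace (initial_topology S D) = S"
proof -
  have "(\<lambda>f\<in>D. f x) \<in> topspace (powertop_real D)" for x
    by simp
  then show ?thesis
    unfolding initial_topology_def topspace_pullback_topology by blast
qed

lemma Tychonoff_space_initial_topology:
  assumes "\<And>x y. x \<in> S \<Longrightarrow> y \<in> S \<Longrightarrow> x \<noteq> y \<Longrightarrow> \<exists>f\<in>D. f x \<noteq> f y"
  shows "Tychonoff_space (initial_topology S D)"
  unfolding initial_topology_def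
proof (rule Tychonoff_space_pullback)
  have "completely_regular_space euclideanreal"
    by (rule metrizable_imp_completely_regular_space[OF metrizable_space_euclidean])
  then show "Tychonoff_space (powertop_real D)"
    by (simp add: Tychonoff_space_def completely_regular_space_product_topology
        Hausdorff_space_product_topology)
  show "inj_on (\<lambda>x. \<lambda>f\<in>D. f x) S"
    unfolding inj_on_def restrict_def by (metis assms)
qed auto

lemma continuous_map_id_initial_topology:
  assumes "\<And>f. f \<in> D \<Longrightarrow> continuous_map X euclideanreal f"
  shows "continuous_map X (initial_topology (topspace X) D) id"
  unfolding initial_topology_def using assms
  by (intro continuous_map_pullback') (auto simp: continuous_map_componentwise)

lemma openin_initial_topology:
  assumes "f \<in> D" and "open V"
  shows "openin (initial_topology S D) {x \<in> S. f x \<in> V}"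
proof -
  have "openin (powertop_real D) {g \<in> topspace (powertop_real D). g f \<in> V}"
    using assms continuous_map_product_projection[of f D "\<lambda>_. euclideanreal"]
    by (intro openin_continuous_map_preimage[where Y = euclideanreal]) simp_all
  moreover have "{x \<in> S. f x \<in> V} = (\<lambda>x. \<lambda>f\<in>D. f x) -` {g \<in> topspace (powertop_real D). g f \<in> V} \<inter> S"
    using assms(1) by auto
  ultimately show ?thesis
    unfolding initial_topology_def openin_pullback_topology by blast
qed

lemma binary_hull_Int_local:
  assumes "finite J" and "x \<in> S" "S \<in> G"
    and "\<And>j. j \<in> J \<Longrightarrow> \<exists>b\<in>G. x \<in> b \<and> b \<subseteq> Q j"
  shows "\<exists>b\<in>binary_hull {(\<inter>)} G. x \<in> b \<and> b \<subseteq> S \<and> (\<forall>j\<in>J. b \<subseteq> Q j)"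
  using assms(1,4)
proof (induction rule: finite_induct)
  case empty
  then show ?case
    using assms(2,3) by (auto intro: binary_hull.base)
next
  case (insert j J)
  have "\<exists>b\<in>binary_hull {(\<inter>)} G. x \<in> b \<and> b \<subseteq> S \<and> (\<forall>j\<in>J. b \<subseteq> Q j)"
    using insert.prems by (intro insert.IH) simp
  then obtain b where b: "b \<in> binary_hull {(\<inter>)} G" "x \<in> b" "b \<subseteq> S" "\<forall>j\<in>J. b \<subseteq> Q j"
    by blast
  obtain c where c: "c \<in> G" "x \<in> c" "c \<subseteq> Q j"
    using insert.prems[of j] by blast
  have "b \<inter> c \<in> binary_hull {(\<inter>)} G"
    using binary_hull.step[of "(\<inter>)" "{(\<inter>)}" b G c] b(1) c(1) by (simp add: binary_hull.base)
  then show ?case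
    using b c by (intro bexI[of _ "b \<inter> c"]) auto
qed

text \<open>
  A subbase consists of the preimages of rational intervals under members of \<open>D\<close>; finite
  intersections of its members form a base.
\<close>

lemma weight_initial_topology:
  fixes D :: "('a \<Rightarrow> real) set"
  assumes r: "Cinfinite r" and D: "|D| \<le>o r"
  shows "weight (initial_topology S D) \<le>o r"
proof -
  define G where "G = {S} \<union>
    (\<lambda>(f, p::rat, q::rat). {x \<in> S. f x \<in> {of_rat p<..<of_rat q}}) ` (D \<times> UNIV \<times> UNIV)"
  define B where "B = binary_hull {(\<inter>)} G"
  have rat: "|UNIV :: rat set| \<le>o r"
    using r by (intro card_of_countable_ordLeq) auto
  have inf: "infinite (Field r)" and co: "Card_order r"
    using r by (auto simp: cinfinite_def)
  have "|D \<times> UNIV \<times> UNIV :: (('a \<Rightarrow> real) \<times> rat \<times> rat) set| \<le>o r"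
    by (intro card_of_Times_ordLeq_infinite_Field inf co D rat)
  moreover have "|{S}| \<le>o r"
    using r by (intro card_of_countable_ordLeq) auto
  ultimately have "|G| \<le>o r"
    unfolding G_def
    by (intro card_of_Un_ordLeq_infinite_Field inf co ordLeq_transitive[OF card_of_image])
  then have "|B| \<le>o r"
    unfolding B_def using card_of_countable_ordLeq[OF r, of "{(\<inter>)}"]
    by (intro card_of_binary_hull[OF r]) auto
  moreover have "base_of (initial_topology S D) B"
    unfolding base_of_def
  proof (intro conjI ballI allI impI, goal_cases)
    case (1 b)
    then show ?case
      unfolding B_def
    proof induction
      case (base b)
      then show ?case
        using openin_topspace[of "initial_topology S D"]
        by (auto simp: G_def simp del: greaterThanLessThan_iff intro!: openin_initial_topology)
    qed (auto intro: openin_Int)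
  next
    case (2 U x)
    then obtain V where V: "openin (powertop_real D) V" "U = (\<lambda>x. \<lambda>f\<in>D. f x) -` V \<inter> S"
      unfolding initial_topology_def openin_pullback_topology by blast
    with 2 have x: "x \<in> S" "(\<lambda>f\<in>D. f x) \<in> V" by auto
    then have "\<exists>W. finite {f \<in> D. W f \<noteq> UNIV} \<and> (\<forall>f\<in>D. open (W f)) \<and>
        (\<lambda>f\<in>D. f x) \<in> Pi\<^sub>E D W \<and> Pi\<^sub>E D W \<subseteq> V"
      using bspec[OF V(1)[unfolded openin_product_topology_alt] x(2)]
      by (simp only: topspace_euclidean open_openin[symmetric])
    then obtain W where W: "finite {f \<in> D. W f \<noteq> UNIV}" "\<forall>f\<in>D. open (W f)"
      "(\<lambda>f\<in>D. f x) \<in> Pi\<^sub>E D W" "Pi\<^sub>E D W \<subseteq> V"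
      by (elim exE conjE) 
    have "\<exists>b\<in>G. x \<in> b \<and> b \<subseteq> {y \<in> S. f y \<in> W f}" if f: "f \<in> {f \<in> D. W f \<noteq> UNIV}" for f
    proof -
      have "f x \<in> W f"
        using W(3) f by (auto simp: PiE_def Pi_def)
      then obtain e where "e > 0" and e: "ball (f x) e \<subseteq> W f"
        using W(2) f open_contains_ball by blast
      obtain p q where "f x - e < of_rat p" "of_rat p < f x" "f x < of_rat q" "of_rat q < f x + e"
        using of_rat_dense[of "f x - e" "f x"] of_rat_dense[of "f x" "f x + e"] \<open>e > 0\<close> by auto
      moreover from this have "{of_rat p<..<of_rat q} \<subseteq> ball (f x) e"
        by (auto simp: dist_real_def abs_less_iff)
      moreover have "{y \<in> S. f y \<in> {of_rat p<..<of_rat q}} \<in> G"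
        unfolding G_def using f by (intro UnI2 image_eqI[of _ _ "(f, p, q)"]) simp_all
      ultimately show ?thesis
        using e x(1) by (intro bexI[of _ "{y \<in> S. f y \<in> {of_rat p<..<of_rat q}}"]) auto
    qed
    moreover have "S \<in> G"
      by (simp add: G_def)
    ultimately have "\<exists>b\<in>B. x \<in> b \<and> b \<subseteq> S \<and> (\<forall>f\<in>{f \<in> D. W f \<noteq> UNIV}. b \<subseteq> {y \<in> S. f y \<in> W f})"
      unfolding B_def using W(1) x(1)
      by (intro binary_hull_Int_local[where Q = "\<lambda>f. {y \<in> S. f y \<in> W f}"])
    then obtain b where b: "b \<in> B" "x \<in> b" "b \<subseteq> S"
      "\<forall>f\<in>{f \<in> D. W f \<noteq> UNIV}. b \<subseteq> {y \<in> S. f y \<in> W f}"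
      by (elim bexE conjE)
    have "b \<subseteq> U"
    proof
      fix y assume "y \<in> b"
      then have "(\<lambda>f\<in>D. f y) \<in> Pi\<^sub>E D W"
        using b(4) by fastforce
      then have "(\<lambda>f\<in>D. f y) \<in> V"
        using W(4) by (rule subsetD[rotated])
      then show "y \<in> U"
        using \<open>y \<in> b\<close> b(3) unfolding V(2) by auto
    qed
    with b(1,2) show ?case by (intro bexI conjI)
  qed
  ultimately show ?thesis
    using weight_le ordLeq_transitive by blast
qed

section \<open>Dense sets of functions in the pointwise topology\<close>

lemma Lipschitz_imp_Cfun:
  assumes "\<And>x y. x \<in> mspace M \<Longrightarrow> y \<in> mspace M \<Longrightarrow> \<bar>f x - f y\<bar> \<le> C * mdist M x y"
  shows "restrict f (mspace M) \<in> Cfun M"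
proof -
  have "restrict f (mspace M) \<in> LIP M"
    using assms by (auto simp: LIP_def Lipschitz_continuous_map_def dist_real_def)
  then show ?thesis
    using LIP_subset_Cfun by blast
qed

lemma openin_pointwise_topology:
  assumes "x \<in> mspace M" and "open V"
  shows "openin (pointwise_topology M) {f \<in> Cfun M. f x \<in> V}"
proof -
  have "openin (powertop_real (mspace M)) {f \<in> topspace (powertop_real (mspace M)). f x \<in> V}"
    using assms continuous_map_product_projection[of x "mspace M" "\<lambda>_. euclideanreal"]
    by (intro openin_continuous_map_preimage[where Y = euclideanreal]) simp_all
  moreover have "{f \<in> Cfun M. f x \<in> V} = {f \<in> topspace (powertop_real (mspace M)). f x \<in> V} \<inter> Cfun M"
    by (auto simp: Cfun_def PiE_def)
  ultimately show ?thesis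
    unfolding pointwise_topology_def openin_subtopology by blast
qed

text \<open>
  The distance from \<open>x\<close> takes different values at \<open>x\<close> and \<open>y\<close>; a member of \<open>D\<close> that is close to it at
  these two points separates them.
\<close>

lemma pointwise_dense_separates:
  assumes D: "dense_in (pointwise_topology M) D"
    and xy: "x \<in> mspace M" "y \<in> mspace M" "x \<noteq> y"
  shows "\<exists>f\<in>D. f x \<noteq> f y"
proof -
  define e where "e = mdist M x y"
  have "e > 0"
    using xy mdist_zero[OF xy(1,2)] mdist_nonneg[of M x y] unfolding e_def by linarith
  let ?U = "{f \<in> Cfun M. f x \<in> {..<e / 2}} \<inter> {f \<in> Cfun M. f y \<in> {e / 2<..}}"
  have "openin (pointwise_topology M) ?U"
    using xy by (intro openin_Int openin_pointwise_topology) auto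
  moreover have "restrict (mdist M x) (mspace M) \<in> ?U"
  proof -
    have "restrict (mdist M x) (mspace M) \<in> Cfun M"
    proof (rule Lipschitz_imp_Cfun[where C = 1])
      fix y z assume "y \<in> mspace M" "z \<in> mspace M"
      then show "\<bar>mdist M x y - mdist M x z\<bar> \<le> 1 * mdist M y z"
        using xy(1) mdist_triangle[of x M y z] mdist_triangle[of x M z y]
        by (simp add: abs_le_iff mdist_commute)
    qed
    moreover have "mdist M x x < e / 2"
      using \<open>e > 0\<close> mdist_zero[THEN iffD2, OF xy(1,1) refl] by linarith
    ultimately show ?thesis
      using xy \<open>e > 0\<close> by (simp add: e_def)
  qed
  ultimately obtain f where "f \<in> D" "f \<in> ?U"
    using D unfolding dense_in_iff by blast
  then show ?thesis by (intro bexI[of _ f]) auto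
qed

text \<open>
  The values of a finite \<open>D\<close> at \<open>x\<close> are bounded, so some constant function cannot be approached at
  \<open>x\<close>.
\<close>

lemma pointwise_dense_infinite:
  assumes D: "dense_in (pointwise_topology M) D" and x: "x \<in> mspace M"
  shows "infinite D"
proof
  assume "finite D"
  then obtain c where c: "\<And>f. f \<in> D \<Longrightarrow> f x < c"
  proof -
    obtain b where "\<And>f. f \<in> D \<Longrightarrow> f x \<le> b"
      using bdd_above_finite[of "(\<lambda>f. f x) ` D"] \<open>finite D\<close> by (auto simp: bdd_above_def)
    then show thesis
      by (intro that[of "b + 1"]) (meson le_less_trans less_add_one)
  qed
  have "restrict (\<lambda>_. c + 1) (mspace M) \<in> Cfun M"
    by (rule Lipschitz_imp_Cfun[where C = 0]) simp
  then have "restrict (\<lambda>_. c + 1) (mspace M) \<in> {f \<in> Cfun M. f x \<in> {c<..}}"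
    using x by simp
  then have "D \<inter> {f \<in> Cfun M. f x \<in> {c<..}} \<noteq> {}"
    using D openin_pointwise_topology[OF x open_greaterThan] unfolding dense_in_iff by blast
  then obtain f where "f \<in> D" "f x > c"
    by auto
  then show False
    using c[of f] by simp
qed

lemma dense_in_coarser:
  assumes "dense_in X D" and "topspace X = topspace Y" and "\<And>U. openin Y U \<Longrightarrow> openin X U"
  shows "dense_in Y D"
  using assms unfolding dense_in_iff by auto

text \<open>
  The topology that a dense set \<open>D\<close> of continuous functions induces on \<open>M\<close> is contained in the metric
  topology, is Tychonoff because \<open>D\<close> separates points, and has weight at most any infinite cardinal
  that bounds \<open>|D|\<close>.
\<close>

lemma weak_weight_le_function_density:
  assumes "topspace \<tau> = Cfun M" and "\<And>U. openin (pointwise_topology M) U \<Longrightarrow> openin \<tau> U"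
    and r: "Cinfinite r" and "top_density \<tau> \<le>o r"
  shows "weak_weight (mtopology_of M) \<le>o r"
proof -
  obtain D where D: "dense_in \<tau> D" "top_density \<tau> = |D|"
    by (rule top_density_obtain)
  have dense: "dense_in (pointwise_topology M) D"
    by (rule dense_in_coarser[OF D(1)]) (simp_all add: assms(1,2) topspace_pointwise_topology)
  then have DC: "D \<subseteq> Cfun M"
    by (simp add: dense_in_def topspace_pointwise_topology)
  have "weak_weight (mtopology_of M) \<le>o weight (initial_topology (mspace M) D)"
  proof (rule weak_weight_le[where f = id])
    show "Tychonoff_space (initial_topology (mspace M) D)"
      using pointwise_dense_separates[OF dense] by (rule Tychonoff_space_initial_topology)
    show "continuous_map (mtopology_of M) (initial_topology (mspace M) D) id"
      using continuous_map_id_initial_topology[of D "mtopology_of M"] DC by (auto simp: Cfun_def)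
  qed (simp_all add: Tychonoff_space_mtopology_of)
  then show ?thesis
    using weight_initial_topology[OF r] D(2) assms(4) ordLeq_transitive by metis
qed

section \<open>Cardinal invariants of infinite spaces\<close>

text \<open>
  A point of a Hausdorff space is determined by the base sets that contain it.
\<close>

lemma Hausdorff_base_infinite:
  assumes "Hausdorff_space Y" "base_of Y B" "infinite (topspace Y)"
  shows "infinite B"
proof
  assume "finite B"
  have "inj_on (\<lambda>x. {b \<in> B. x \<in> b}) (topspace Y)"
  proof (rule inj_onI, rule ccontr)
    fix x y assume xy: "x \<in> topspace Y" "y \<in> topspace Y" "{b \<in> B. x \<in> b} = {b \<in> B. y \<in> b}" "x \<noteq> y"
    obtain U V where UV: "openin Y U" "x \<in> U" "y \<in> V" "disjnt U V"
      using assms(1) xy(1,2,4) unfolding Hausdorff_space_def by meson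
    then obtain b where "b \<in> B" "x \<in> b" "b \<subseteq> U"
      using assms(2) unfolding base_of_def by meson
    then have "y \<notin> b"
      using UV(3,4) by (auto simp: disjnt_iff)
    with xy(3) \<open>b \<in> B\<close> \<open>x \<in> b\<close> show False by blast
  qed
  moreover have "finite ((\<lambda>x. {b \<in> B. x \<in> b}) ` topspace Y)"
    by (rule finite_subset[of _ "Pow B"]) (use \<open>finite B\<close> in auto)
  ultimately show False
    using assms(3) finite_imageD[of "\<lambda>x. {b \<in> B. x \<in> b}" "topspace Y"] by simp
qed

lemma Cinfinite_weak_weight:
  fixes X :: "'a topology"
  assumes "Tychonoff_space X" "infinite (topspace X)"
  shows "Cinfinite (weak_weight X)"
proof -
  obtain Y :: "'a topology" and \<phi> where Y: "Tychonoff_space Y" "continuous_map X Y \<phi>"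
    "bij_betw \<phi> (topspace X) (topspace Y)" "weak_weight X = weight Y"
    by (rule weak_weight_obtain[OF assms(1)])
  obtain B where B: "base_of Y B" "weight Y = |B|"
    by (rule weight_obtain)
  have "infinite (topspace Y)"
    using Y(3) assms(2) bij_betw_finite by blast
  then have "infinite B"
    using Hausdorff_base_infinite[OF _ B(1)] Y(1) by (simp add: Tychonoff_space_def)
  then show ?thesis
    unfolding Y(4) B(2) by (rule Cinfinite_card_of)
qed

lemma Cinfinite_density_Hausdorff:
  assumes "Hausdorff_space X" "infinite (topspace X)"
  shows "Cinfinite (top_density X)"
proof -
  obtain D where D: "dense_in X D" "top_density X = |D|"
    by (rule top_density_obtain)
  have "infinite D"
  proof
    assume "finite D"
    then have "closedin X D"
      using assms(1) D(1) by (intro closedin_Hausdorff_finite) (auto simp: dense_in_def)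
    then have "D = topspace X"
      using D(1) by (simp add: dense_in_def closure_of_closedin)
    then show False
      using \<open>finite D\<close> assms(2) by simp
  qed
  then show ?thesis
    unfolding D(2) by (rule Cinfinite_card_of)
qed

lemma Card_order_top_density: "Card_order (top_density X)"
proof -
  obtain D where "top_density X = |D|"
    by (rule top_density_obtain)
  then show ?thesis
    by (simp only: card_of_Card_order)
qed

lemma Card_order_weak_weight:
  fixes X :: "'a topology"
  assumes "Tychonoff_space X"
  shows "Card_order (weak_weight X)"
proof -
  obtain Y :: "'a topology" where "weak_weight X = weight Y"
    by (rule weak_weight_obtain[OF assms])
  then show ?thesis
    by (simp only: Card_order_weight)
qed

section \<open>Density of the space of Lipschitz functions\<close>

theorem theorem3p8:
  fixes M :: "'a metric" and \<tau> :: "('a \<Rightarrow> real) topology"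
  assumes "topspace \<tau> = Cfun M"
    and "\<forall>U. openin (pointwise_topology M) U \<longrightarrow> openin \<tau> U"
    and "\<forall>U. openin \<tau> U \<longrightarrow> openin (compact_open_topology M) U"
  shows "dense_in \<tau> (LIP M) \<and>
    (infinite (mspace M) \<longrightarrow>
       weak_weight (mtopology_of M) =o top_density \<tau> \<and>
       top_density \<tau> =o top_density (subtopology \<tau> (LIP M)) \<and>
       top_density (subtopology \<tau> (LIP M)) \<le>o top_density (mtopology_of M)) \<and>
    weak_weight (mtopology_of M) +c natLeq =o top_density \<tau> +c natLeq \<and>
    top_density \<tau> +c natLeq =o top_density (subtopology \<tau> (LIP M)) +c natLeq \<and>
    top_density (subtopology \<tau> (LIP M)) +c natLeq \<le>o top_density (mtopology_of M) +c natLeq"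
proof -
  let ?w = "weak_weight (mtopology_of M)" and ?c = "top_density \<tau>"
    and ?l = "top_density (subtopology \<tau> (LIP M))" and ?m = "top_density (mtopology_of M)"
  have dense: "dense_in \<tau> (LIP M)"
    using LIP_dense[OF assms(1)] assms(3) by blast
  have w_le: "?w \<le>o r" if "Cinfinite r" "?c \<le>o r" for r :: "'r rel"
    using weak_weight_le_function_density[OF assms(1) _ that] assms(2) by blast
  have l_le: "?l \<le>o r" if "Cinfinite r" "?w \<le>o r" for r :: "'r rel"
    using LIP_density_le_weak_weight[OF assms(1) _ that] assms(3) by blast
  
  have m_le: "?w \<le>o r" if "Cinfinite r" "?m \<le>o r" for r :: "'r rel"
    using that by (rule weak_weight_le_density)
  have cl: "?c \<le>o ?l"
    using dense by (rule density_le_density_of_dense)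
  have co: "Card_order ?w" "Card_order ?c" "Card_order ?l" "Card_order ?m"
    by (intro Card_order_weak_weight Tychonoff_space_mtopology_of Card_order_top_density)+
  have wc: "?w +c natLeq \<le>o ?c +c natLeq"
    by (rule csum_natLeq_mono[OF co(1,2) w_le])
  have lw: "?l +c natLeq \<le>o ?w +c natLeq"
    by (rule csum_natLeq_mono[OF co(3,1) l_le])
  have wm: "?w +c natLeq \<le>o ?m +c natLeq"
    by (rule csum_natLeq_mono[OF co(1,4) m_le])
  have cl': "?c +c natLeq \<le>o ?l +c natLeq"
    using cl by (rule csum_mono1)
  have inf: "?w =o ?c \<and> ?c =o ?l \<and> ?l \<le>o ?m" if "infinite (mspace M)"
  proof -
    have w: "Cinfinite ?w"
      using that by (intro Cinfinite_weak_weight Tychonoff_space_mtopology_of) simp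
    have m: "Cinfinite ?m"
      using that Tychonoff_space_mtopology_of[of M]
      by (intro Cinfinite_density_Hausdorff) (simp_all add: Tychonoff_space_def)
    obtain D where D: "dense_in \<tau> D" "?c = |D|"
      by (rule top_density_obtain)
    have "dense_in (pointwise_topology M) D"
      by (rule dense_in_coarser[OF D(1)]) (simp_all add: assms(1,2) topspace_pointwise_topology)
    then have "infinite D"
      using pointwise_dense_infinite that by (metis finite.emptyI ex_in_conv)
    then have c: "Cinfinite ?c"
      unfolding D(2) by (rule Cinfinite_card_of)
    have wc: "?w \<le>o ?c" and lw: "?l \<le>o ?w" and wm: "?w \<le>o ?m"
      using w_le[OF c ordLeq_refl[OF co(2)]] l_le[OF w ordLeq_refl[OF co(1)]]
        m_le[OF m ordLeq_refl[OF co(4)]] .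
    show ?thesis
      unfolding ordIso_iff_ordLeq
      using wc cl lw ordLeq_transitive[OF cl lw] ordLeq_transitive[OF lw wc]
        ordLeq_transitive[OF lw wm] by simp
  qed
  have inf_sum: "?w +c natLeq =o ?c +c natLeq \<and> ?c +c natLeq =o ?l +c natLeq \<and>
      ?l +c natLeq \<le>o ?m +c natLeq"
    unfolding ordIso_iff_ordLeq
    using wc cl' ordLeq_transitive[OF cl' lw] ordLeq_transitive[OF lw wc]
      ordLeq_transitive[OF lw wm] by simp
  show ?thesis
    using dense inf inf_sum by simp
qed

end
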